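(* If $\models_{\mathbf{A}} G$ for a hypersequent $G$, then for every propositional variable $p$ the focused hypersequent $[p]G$ is derivable in $\mathbf{GA_t}$.
   Context: Formulas are built from propositional variables and $t$ using $+,\to,\land,\lor,\lnot$. A sequent (component) is a pair of finite multisets $\Gamma\vdash\Delta$; a hypersequent a finite multiset of components. $\models_{\mathbf{A}}G$ means: for every valuation into $\mathbb{Q}$ ($t=0$, $+$ addition, $\lnot$ negation, $A\to B$ valued $v(B)-v(A)$, $\land=\min$, $\lor=\max$) some component $\Gamma_i\vdash\Delta_i$ of $G$ has $\sum v(\Gamma_i)\le\sum v(\Delta_i)$ (empty sum $0$). A focused hypersequent $[q]G$ is a hypersequent $G$ together with a propositional variable $q$. $m\Gamma$ is $m$ copies of $\Gamma$, $np$ is $n$ copies of $p$; "atomic" means consisting of propositional variables. Calculus $\mathbf{GA_t}$ (same focus $[q]$ in premises and conclusion unless stated; each logical rule carries a side hypersequent $[q]G\mid$): axioms $[q]A\vdash A$ and $[q]\vdash$; (EW) from $[q]G\mid\Gamma\vdash\Delta$ infer $[q]G\mid\Gamma\vdash\Delta\mid\Gamma'\vdash\Delta'$; (M) from $[q]G\mid\Gamma_1\vdash\Delta_1$ and $[q]G\mid\Gamma_2\vdash\Delta_2$ infer $[q]G\mid\Gamma_1,\Gamma_2\vdash\Delta_1,\Delta_2$; logical rules $(t,l)$ $\Gamma\vdash\Delta/\Gamma,t\vdash\Delta$; $(t,r)$ $\Gamma\vdash\Delta/\Gamma\vdash t,\Delta$; $(\lnot,l)$ $\Gamma\vdash A,\Delta/\Gamma,\lnot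 A\vdash\Delta$; $(\lnot,r)$ $\Gamma,A\vdash\Delta/\Gamma\vdash\lnot A,\Delta$; $(\to,l)$ $\Gamma,B\vdash A,\Delta/\Gamma,A\to B\vdash\Delta$; $(\to,r)$ $\Gamma,A\vdash B,\Delta/\Gamma\vdash A\to B,\Delta$; $(+,l)$ $\Gamma,A,B\vdash\Delta/\Gamma,A+B\vdash\Delta$; $(+,r)$ $\Gamma\vdash A,B,\Delta/\Gamma\vdash A+B,\Delta$; $(\land,l)$ $\Gamma,A\vdash\Delta\mid\Gamma,B\vdash\Delta/\Gamma,A\land B\vdash\Delta$; $(\land,r)$ premises $\Gamma\vdash A,\Delta$ and $\Gamma\vdash B,\Delta$, conclusion $\Gamma\vdash A\land B,\Delta$; $(\lor,l)$ premises $\Gamma,A\vdash\Delta$ and $\Gamma,B\vdash\Delta$, conclusion $\Gamma,A\lor B\vdash\Delta$; $(\lor,r)$ $\Gamma\vdash A,\Delta\mid\Gamma\vdash B,\Delta/\Gamma\vdash A\lor B,\Delta$; (shift) from $[q]G$ infer $[p]G$ provided $q$ occurs in $G$ and $p$ does not; (S') from $[p]G\mid m\Gamma_1,n\Gamma_2\vdash m\Delta_1,n\Delta_2\mid S$ infer $[p]G\mid\Gamma_1,np\vdash\Delta_1\mid\Gamma_2\vdash\Delta_2,mp$, provided $\Gamma_1,\Gamma_2,\Delta_1,\Delta_2$ atomic, $n,m>0$, $p$ not in $\Gamma_1,\Delta_1,\Gamma_2,\Delta_2$, and $S$ is $\Gamma_1,np\vdash\Delta_1$ or $\Gamma_2\vdash\Delta_2,mp$.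 *)

theory Defs
  imports Complex_Main "HOL-Library.Multiset"
begin

type_synonym pvar = nat

datatype fm =
    Var pvar
  | Tt  (\<open>\<^bold>t\<close>)
  | Plus fm fm  (infixl \<open>\<^bold>+\<close> 120)
  | Imp fm fm   (infixr \<open>\<^bold>\<rightarrow>\<close> 105)
  | And fm fm   (infixr \<open>\<^bold>\<and>\<close> 115)
  | Or fm fm    (infixr \<open>\<^bold>\<or>\<close> 110)
  | Neg fm      (\<open>\<^bold>\<not> _\<close> [130] 130)

datatype sequent = Sequent "fm multiset" "fm multiset"  (infix \<open>\<turnstile>\<close> 55)

type_synonym hypersequent = "sequent multiset"

primrec eval :: "(pvar \<Rightarrow> rat) \<Rightarrow> fm \<Rightarrow> rat" where
  "eval v (Var p) = v p"
| "eval v \<^bold>t = 0"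
| "eval v (A \<^bold>+ B) = eval v A + eval v B"
| "eval v (A \<^bold>\<rightarrow> B) = eval v B - eval v A"
| "eval v (A \<^bold>\<and> B) = min (eval v A) (eval v B)"
| "eval v (A \<^bold>\<or> B) = max (eval v A) (eval v B)"
| "eval v (\<^bold>\<not> A) = - eval v A"

primrec holds :: "(pvar \<Rightarrow> rat) \<Rightarrow> sequent \<Rightarrow> bool" where
  "holds v (\<Gamma> \<turnstile> \<Delta>) \<longleftrightarrow> (\<Sum>A\<in>#\<Gamma>. eval v A) \<le> (\<Sum>A\<in>#\<Delta>. eval v A)"

definition valid :: "hypersequent \<Rightarrow> bool"  (\<open>\<Turnstile>\<^sub>A _\<close> [50] 50) where
  "\<Turnstile>\<^sub>A G \<longleftrightarrow> (\<forall>v. \<exists>s\<in>#G. holds v s)"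

primrec fm_vars :: "fm \<Rightarrow> pvar set" where
  "fm_vars (Var p) = {p}"
| "fm_vars \<^bold>t = {}"
| "fm_vars (A \<^bold>+ B) = fm_vars A \<union> fm_vars B"
| "fm_vars (A \<^bold>\<rightarrow> B) = fm_vars A \<union> fm_vars B"
| "fm_vars (A \<^bold>\<and> B) = fm_vars A \<union> fm_vars B"
| "fm_vars (A \<^bold>\<or> B) = fm_vars A \<union> fm_vars B"
| "fm_vars (\<^bold>\<not> A) = fm_vars A"

definition mset_vars :: "fm multiset \<Rightarrow> pvar set" where
  "mset_vars \<Gamma> = (\<Union>A\<in>set_mset \<Gamma>. fm_vars A)"

primrec seq_vars :: "sequent \<Rightarrow> pvar set" where
  "seq_vars (\<Gamma> \<turnstile> \<Delta>) = mset_vars \<Gamma> \<union> mset_vars \<Delta>"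

definition hseq_vars :: "hypersequent \<Rightarrow> pvar set" where
  "hseq_vars G = (\<Union>s\<in>set_mset G. seq_vars s)"

definition atomic :: "fm multiset \<Rightarrow> bool" where
  "atomic \<Gamma> \<longleftrightarrow> (\<forall>A\<in>#\<Gamma>. \<exists>p. A = Var p)"

(* GAt q G: the focused hypersequent [q]G is derivable. *)
inductive GAt :: "pvar \<Rightarrow> hypersequent \<Rightarrow> bool" where
  Ax: "GAt q {# {#A#} \<turnstile> {#A#} #}"
| AxEmpty: "GAt q {# {#} \<turnstile> {#} #}"
| EW: "GAt q (G + {# \<Gamma> \<turnstile> \<Delta> #})
    \<Longrightarrow> GAt q (G + {# \<Gamma> \<turnstile> \<Delta> #} + {# \<Gamma>' \<turnstile> \<Delta>' #})"
| M: "GAt q (G + {# \<Gamma>1 \<turnstile> \<Delta>1 #}) \<Longrightarrow> GAt q (G + {# \<Gamma>2 \<turnstile> \<Delta>2 #})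
    \<Longrightarrow> GAt q (G + {# \<Gamma>1 + \<Gamma>2 \<turnstile> \<Delta>1 + \<Delta>2 #})"
| tL: "GAt q (G + {# \<Gamma> \<turnstile> \<Delta> #}) \<Longrightarrow> GAt q (G + {# \<Gamma> + {#\<^bold>t#} \<turnstile> \<Delta> #})"
| tR: "GAt q (G + {# \<Gamma> \<turnstile> \<Delta> #}) \<Longrightarrow> GAt q (G + {# \<Gamma> \<turnstile> {#\<^bold>t#} + \<Delta> #})"
| NegL: "GAt q (G + {# \<Gamma> \<turnstile> {#A#} + \<Delta> #}) \<Longrightarrow> GAt q (G + {# \<Gamma> + {#\<^bold>\<not> A#} \<turnstile> \<Delta> #})"
| NegR: "GAt q (G + {# \<Gamma> + {#A#} \<turnstile> \<Delta> #}) \<Longrightarrow> GAt q (G + {# \<Gamma> \<turnstile> {#\<^bold>\<not> A#} + \<Delta> #})"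
| ImpL: "GAt q (G + {# \<Gamma> + {#B#} \<turnstile> {#A#} + \<Delta> #})
    \<Longrightarrow> GAt q (G + {# \<Gamma> + {#A \<^bold>\<rightarrow> B#} \<turnstile> \<Delta> #})"
| ImpR: "GAt q (G + {# \<Gamma> + {#A#} \<turnstile> {#B#} + \<Delta> #})
    \<Longrightarrow> GAt q (G + {# \<Gamma> \<turnstile> {#A \<^bold>\<rightarrow> B#} + \<Delta> #})"
| PlusL: "GAt q (G + {# \<Gamma> + {#A, B#} \<turnstile> \<Delta> #})
    \<Longrightarrow> GAt q (G + {# \<Gamma> + {#A \<^bold>+ B#} \<turnstile> \<Delta> #})"
| PlusR: "GAt q (G + {# \<Gamma> \<turnstile> {#A, B#} + \<Delta> #})
    \<Longrightarrow> GAt q (G + {# \<Gamma> \<turnstile> {#A \<^bold>+ B#} + \<Delta> #})"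
| AndL: "GAt q (G + {# \<Gamma> + {#A#} \<turnstile> \<Delta> #} + {# \<Gamma> + {#B#} \<turnstile> \<Delta> #})
    \<Longrightarrow> GAt q (G + {# \<Gamma> + {#A \<^bold>\<and> B#} \<turnstile> \<Delta> #})"
| AndR: "GAt q (G + {# \<Gamma> \<turnstile> {#A#} + \<Delta> #}) \<Longrightarrow> GAt q (G + {# \<Gamma> \<turnstile> {#B#} + \<Delta> #})
    \<Longrightarrow> GAt q (G + {# \<Gamma> \<turnstile> {#A \<^bold>\<and> B#} + \<Delta> #})"
| OrL: "GAt q (G + {# \<Gamma> + {#A#} \<turnstile> \<Delta> #}) \<Longrightarrow> GAt q (G + {# \<Gamma> + {#B#} \<turnstile> \<Delta> #})
    \<Longrightarrow> GAt q (G + {# \<Gamma> + {#A \<^bold>\<or> B#} \<turnstile> \<Delta> #})"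
| OrR: "GAt q (G + {# \<Gamma> \<turnstile> {#A#} + \<Delta> #} + {# \<Gamma> \<turnstile> {#B#} + \<Delta> #})
    \<Longrightarrow> GAt q (G + {# \<Gamma> \<turnstile> {#A \<^bold>\<or> B#} + \<Delta> #})"
| shift: "GAt q G \<Longrightarrow> q \<in> hseq_vars G \<Longrightarrow> p \<notin> hseq_vars G \<Longrightarrow> GAt p G"
| S': "GAt p (G + {# repeat_mset m \<Gamma>1 + repeat_mset n \<Gamma>2
                  \<turnstile> repeat_mset m \<Delta>1 + repeat_mset n \<Delta>2 #} + {# S #})
    \<Longrightarrow> atomic \<Gamma>1 \<Longrightarrow> atomic \<Gamma>2 \<Longrightarrow> atomic \<Delta>1 \<Longrightarrow> atomic \<Delta>2
    \<Longrightarrow> n > 0 \<Longrightarrow> m > 0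
    \<Longrightarrow> p \<notin> mset_vars \<Gamma>1 \<Longrightarrow> p \<notin> mset_vars \<Delta>1 \<Longrightarrow> p \<notin> mset_vars \<Gamma>2 \<Longrightarrow> p \<notin> mset_vars \<Delta>2
    \<Longrightarrow> S = (\<Gamma>1 + replicate_mset n (Var p) \<turnstile> \<Delta>1) \<or>
        S = (\<Gamma>2 \<turnstile> \<Delta>2 + replicate_mset m (Var p))
    \<Longrightarrow> GAt p (G + {# \<Gamma>1 + replicate_mset n (Var p) \<turnstile> \<Delta>1 #}
                 + {# \<Gamma>2 \<turnstile> \<Delta>2 + replicate_mset m (Var p) #})"

end

(* The proof searches backwards through rule instances whose premises stay valid.  For
   the logical rules validity of the premises is immediate, which reduces the claim to
   atomic hypersequents, where sequents are linear forms in the valuation.  There the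
   focused variable p is eliminated, its number of occurrences decreasing at each step.
   The key point is (S'): if both possible premises of an instance were refutable, say by
   v1 and v2, then a suitable positive linear combination of v1 and v2 would refute the
   conclusion, so at least one choice of S gives a valid premise.  Once p occurs on at
   most one side of the turnstile throughout, any component containing it can be refuted
   by making p extreme, so that component is discarded by (EW).  When p is gone, (shift)
   moves the focus. *)

theory Submission
  imports Defs
begin

section \<open>Reduction to atomic hypersequents\<close>

definition atomic_seq :: "sequent \<Rightarrow> bool" where
  "atomic_seq s \<longleftrightarrow> (case s of \<Gamma> \<turnstile> \<Delta> \<Rightarrow> atomic \<Gamma> \<and> atomic \<Delta>)"

lemma atomic_seq_simps [simp]: "atomic_seq (\<Gamma> \<turnstile> \<Delta>) \<longleftrightarrow> atomic \<Gamma> \<and> atomic \<Delta>"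
  by (simp add: atomic_seq_def)

lemma atomic_simps [simp]:
  "atomic {#}"
  "atomic (add_mset A \<Gamma>) \<longleftrightarrow> (\<exists>p. A = Var p) \<and> atomic \<Gamma>"
  "atomic (\<Gamma> + \<Delta>) \<longleftrightarrow> atomic \<Gamma> \<and> atomic \<Delta>"
  by (auto simp: atomic_def)

lemma atomic_repeat_mset: "atomic \<Gamma> \<Longrightarrow> atomic (repeat_mset n \<Gamma>)"
  by (induction n) auto

text \<open>Serves to read rules backwards: \<open>X\<close> holds the active component of the
  conclusion, \<open>Y\<close> what replaces it in a premise. \<open>Y\<close> is a multiset because
  \<open>AndL\<close> and \<open>OrR\<close> leave two components.\<close>

lemma valid_replace:
  assumes "\<Turnstile>\<^sub>A G + X"
    and "\<And>v s. s \<in># X \<Longrightarrow> holds v s \<Longrightarrow> \<exists>s'\<in>#Y. holds v s'"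
  shows "\<Turnstile>\<^sub>A G + Y"
  using assms unfolding valid_def by (metis union_iff)

lemma valid_nonempty: "\<Turnstile>\<^sub>A G \<Longrightarrow> G \<noteq> {#}"
  by (auto simp: valid_def)

text \<open>Iterates (EW), whose premise must already contain a component; hence the
  nonemptiness.\<close>

lemma GAt_weaken:
  assumes "GAt q G" "G \<noteq> {#}"
  shows "GAt q (G + H)"
proof (induction H)
  case empty
  then show ?case using assms by simp
next
  case (add s H)
  obtain s0 K where "G + H = K + {#s0#}"
    using assms(2) by (metis add_mset_add_single multiset_cases union_eq_empty)
  moreover obtain \<Gamma>0 \<Delta>0 \<Gamma> \<Delta> where "s0 = \<Gamma>0 \<turnstile> \<Delta>0" "s = \<Gamma> \<turnstile> \<Delta>"
    by (metis sequent.exhaust)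
  ultimately have "GAt q (G + H + {#s#})"
    using EW[of q K \<Gamma>0 \<Delta>0 \<Gamma> \<Delta>] add.IH by simp
  then show ?case by simp
qed

text \<open>The summand 1 makes deleting a \<open>Tt\<close> lower the weight. The factor 2 then
  lets a binary connective still outweigh its two arguments listed separately, as after
  \<open>PlusL\<close> or \<open>ImpL\<close>.\<close>

definition mset_weight :: "fm multiset \<Rightarrow> nat" where
  "mset_weight \<Gamma> = (\<Sum>A\<in>#\<Gamma>. 2 * size A + 1)"

primrec seq_weight :: "sequent \<Rightarrow> nat" where
  "seq_weight (\<Gamma> \<turnstile> \<Delta>) = mset_weight \<Gamma> + mset_weight \<Delta>"

text \<open>The base 3 makes two components of smaller weight cheaper than the one they replace,
  as needed for the branching of \<open>(\<and>,l)\<close> and \<open>(\<or>,r)\<close> within one premise.\<close>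

definition hseq_weight :: "hypersequent \<Rightarrow> nat" where
  "hseq_weight G = (\<Sum>s\<in>#G. 3 ^ seq_weight s)"

lemma mset_weight_simps [simp]:
  "mset_weight {#} = 0"
  "mset_weight (add_mset A \<Gamma>) = 2 * size A + 1 + mset_weight \<Gamma>"
  "mset_weight (\<Gamma> + \<Delta>) = mset_weight \<Gamma> + mset_weight \<Delta>"
  by (auto simp: mset_weight_def)

lemma hseq_weight_replace1:
  "seq_weight s' < seq_weight s \<Longrightarrow> hseq_weight (G + {#s'#}) < hseq_weight (G + {#s#})"
  by (simp add: hseq_weight_def)

lemma hseq_weight_replace2:
  assumes "seq_weight s1 < seq_weight s" "seq_weight s2 < seq_weight s"
  shows "hseq_weight (G + {#s1#} + {#s2#}) < hseq_weight (G + {#s#})"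
proof -
  obtain w where w: "seq_weight s = Suc w" using assms(1) by (cases "seq_weight s") auto
  have "(3::nat) ^ seq_weight s1 \<le> 3 ^ w" "(3::nat) ^ seq_weight s2 \<le> 3 ^ w"
    using assms w by (auto intro!: power_increasing)
  moreover have "(3::nat) ^ w > 0" by simp
  ultimately have "(3::nat) ^ seq_weight s1 + 3 ^ seq_weight s2 < 3 ^ seq_weight s"
    unfolding w power_Suc by linarith
  then show ?thesis by (simp add: hseq_weight_def)
qed

lemma GAt_left_step:
  assumes val: "\<Turnstile>\<^sub>A G + {#\<Gamma> + {#C#} \<turnstile> \<Delta>#}" and C: "\<nexists>p. C = Var p"
    and IH: "\<And>H. hseq_weight H < hseq_weight (G + {#\<Gamma> + {#C#} \<turnstile> \<Delta>#}) \<Longrightarrow> \<Turnstile>\<^sub>A H \<Longrightarrow> GAt q H"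
  shows "GAt q (G + {#\<Gamma> + {#C#} \<turnstile> \<Delta>#})"
proof (cases C)
  case (Var p)
  then show ?thesis using C by simp
next
  case Tt
  show ?thesis unfolding Tt
    by (rule tL, rule IH[OF hseq_weight_replace1 valid_replace[OF val]]) (auto simp: Tt)
next
  case (Plus A B)
  show ?thesis unfolding Plus
    by (rule PlusL, rule IH[OF hseq_weight_replace1 valid_replace[OF val]]) (auto simp: Plus algebra_simps)
next
  case (Imp A B)
  show ?thesis unfolding Imp
    by (rule ImpL, rule IH[OF hseq_weight_replace1 valid_replace[OF val]]) (auto simp: Imp algebra_simps)
next
  \<comment> \<open>The minimum is attained at \<open>A\<close> or at \<open>B\<close>, so for each
    valuation one of the two new components inherits truth; which one depends on the
    valuation.\<close>
  case (And A B)
  have "\<Turnstile>\<^sub>A G + ({#\<Gamma> + {#A#} \<turnstile> \<Delta>#} + {#\<Gamma> + {#B#} \<turnstile> \<Delta>#})"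
    by (rule valid_replace[OF val]) (auto simp: And min_def split: if_splits)
  then show ?thesis unfolding And
    by (intro AndL IH hseq_weight_replace2) (auto simp: And)
next
  case (Or A B)
  show ?thesis unfolding Or
    by (rule OrL; rule IH[OF hseq_weight_replace1 valid_replace[OF val]]) (auto simp: Or)
next
  case (Neg A)
  show ?thesis unfolding Neg
    by (rule NegL, rule IH[OF hseq_weight_replace1 valid_replace[OF val]]) (auto simp: Neg algebra_simps)
qed

lemma GAt_right_step:
  assumes val: "\<Turnstile>\<^sub>A G + {#\<Gamma> \<turnstile> {#C#} + \<Delta>#}" and C: "\<nexists>p. C = Var p"
    and IH: "\<And>H. hseq_weight H < hseq_weight (G + {#\<Gamma> \<turnstile> {#C#} + \<Delta>#}) \<Longrightarrow> \<Turnstile>\<^sub>A H \<Longrightarrow> GAt q H"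
  shows "GAt q (G + {#\<Gamma> \<turnstile> {#C#} + \<Delta>#})"
proof (cases C)
  case (Var p)
  then show ?thesis using C by simp
next
  case Tt
  show ?thesis unfolding Tt
    by (rule tR, rule IH[OF hseq_weight_replace1 valid_replace[OF val]]) (auto simp: Tt)
next
  case (Plus A B)
  show ?thesis unfolding Plus
    by (rule PlusR, rule IH[OF hseq_weight_replace1 valid_replace[OF val]]) (auto simp: Plus algebra_simps)
next
  case (Imp A B)
  show ?thesis unfolding Imp
    by (rule ImpR, rule IH[OF hseq_weight_replace1 valid_replace[OF val]]) (auto simp: Imp algebra_simps)
next
  \<comment> \<open>Dually, the maximum on the right is attained at \<open>A\<close> or at
    \<open>B\<close>.\<close>
  case (Or A B)
  have "\<Turnstile>\<^sub>A G + ({#\<Gamma> \<turnstile> {#A#} + \<Delta>#} + {#\<Gamma> \<turnstile> {#B#} + \<Delta>#})"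
    by (rule valid_replace[OF val]) (auto simp: Or max_def split: if_splits)
  then show ?thesis unfolding Or
    by (intro OrR IH hseq_weight_replace2) (auto simp: Or)
next
  case (And A B)
  show ?thesis unfolding And
    by (rule AndR; rule IH[OF hseq_weight_replace1 valid_replace[OF val]]) (auto simp: And)
next
  case (Neg A)
  show ?thesis unfolding Neg
    by (rule NegR, rule IH[OF hseq_weight_replace1 valid_replace[OF val]]) (auto simp: Neg algebra_simps)
qed

text \<open>Induction on \<open>hseq_weight\<close>. The logical rules keep the focus, so the atomic
  case is invoked for the same \<open>q\<close> throughout.\<close>

lemma GAt_of_atomic:
  assumes at: "\<And>H. (\<forall>s\<in>#H. atomic_seq s) \<Longrightarrow> \<Turnstile>\<^sub>A H \<Longrightarrow> GAt q H"
    and "\<Turnstile>\<^sub>A G"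
  shows "GAt q G"
  using assms(2)
proof (induction "hseq_weight G" arbitrary: G rule: less_induct)
  case less
  show ?case
  proof (cases "\<forall>s\<in>#G. atomic_seq s")
    case True
    then show ?thesis using at less.prems by blast
  next
    case False
    then obtain \<Gamma> \<Delta> where s: "(\<Gamma> \<turnstile> \<Delta>) \<in># G" and "\<not> atomic \<Gamma> \<or> \<not> atomic \<Delta>"
      by (metis atomic_seq_simps sequent.exhaust)
    obtain G' where G: "G = G' + {#\<Gamma> \<turnstile> \<Delta>#}"
      using s by (metis add_mset_add_single insert_DiffM)
    from \<open>\<not> atomic \<Gamma> \<or> \<not> atomic \<Delta>\<close> show ?thesis
    proof
      assume "\<not> atomic \<Gamma>"
      then obtain C where C: "C \<in># \<Gamma>" "\<nexists>p. C = Var p" by (auto simp: atomic_def)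
      then have "\<Gamma> = (\<Gamma> - {#C#}) + {#C#}" by simp
      then show ?thesis
        using GAt_left_step[of G' "\<Gamma> - {#C#}" C \<Delta> q] less C G by simp
    next
      assume "\<not> atomic \<Delta>"
      then obtain C where C: "C \<in># \<Delta>" "\<nexists>p. C = Var p" by (auto simp: atomic_def)
      then have "\<Delta> = {#C#} + (\<Delta> - {#C#})" by simp
      then show ?thesis
        using GAt_right_step[of G' \<Gamma> C "\<Delta> - {#C#}" q] less C G by simp
    qed
  qed
qed

section \<open>Atomic sequents as linear forms\<close>

definition msum :: "(pvar \<Rightarrow> rat) \<Rightarrow> fm multiset \<Rightarrow> rat" where
  "msum v \<Gamma> = (\<Sum>A\<in>#\<Gamma>. eval v A)"

text \<open>Taken as right minus left, so that refuting a component means making it strictly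
  negative.\<close>

primrec seq_val :: "(pvar \<Rightarrow> rat) \<Rightarrow> sequent \<Rightarrow> rat" where
  "seq_val v (\<Gamma> \<turnstile> \<Delta>) = msum v \<Delta> - msum v \<Gamma>"

primrec lcount :: "pvar \<Rightarrow> sequent \<Rightarrow> nat" where
  "lcount p (\<Gamma> \<turnstile> \<Delta>) = count \<Gamma> (Var p)"

primrec rcount :: "pvar \<Rightarrow> sequent \<Rightarrow> nat" where
  "rcount p (\<Gamma> \<turnstile> \<Delta>) = count \<Delta> (Var p)"

definition occs :: "pvar \<Rightarrow> hypersequent \<Rightarrow> nat" where
  "occs p G = (\<Sum>s\<in>#G. lcount p s + rcount p s)"

lemma holds_iff_seq_val: "holds v s \<longleftrightarrow> 0 \<le> seq_val v s"
  by (cases s) (simp add: msum_def)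

lemma msum_simps [simp]:
  "msum v {#} = 0"
  "msum v (add_mset A \<Gamma>) = eval v A + msum v \<Gamma>"
  "msum v (\<Gamma> + \<Delta>) = msum v \<Gamma> + msum v \<Delta>"
  by (auto simp: msum_def)

lemma msum_repeat_mset [simp]: "msum v (repeat_mset n \<Gamma>) = of_nat n * msum v \<Gamma>"
  by (induction n) (auto simp: algebra_simps)

lemma msum_replicate_mset [simp]: "msum v (replicate_mset n A) = of_nat n * eval v A"
  by (induction n) (auto simp: algebra_simps)

text \<open>Atomicity excludes min and max, which are not linear in the valuation.\<close>

lemma msum_linear:
  "atomic \<Gamma> \<Longrightarrow> msum (\<lambda>q. x * v q + y * w q) \<Gamma> = x * msum v \<Gamma> + y * msum w \<Gamma>"
  by (induction \<Gamma>) (auto simp: algebra_simps)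

lemma msum_upd:
  "atomic \<Gamma> \<Longrightarrow> msum (v(p := a)) \<Gamma> = msum v \<Gamma> + of_nat (count \<Gamma> (Var p)) * (a - v p)"
  by (induction \<Gamma>) (auto simp: algebra_simps split: if_splits)

lemma seq_val_linear:
  "atomic_seq s \<Longrightarrow> seq_val (\<lambda>q. x * v q + y * w q) s = x * seq_val v s + y * seq_val w s"
  by (cases s) (simp add: msum_linear algebra_simps)

lemma seq_val_upd:
  "atomic_seq s \<Longrightarrow>
    seq_val (v(p := a)) s = seq_val v s + (of_nat (rcount p s) - of_nat (lcount p s)) * (a - v p)"
  by (cases s) (simp add: msum_upd algebra_simps)

lemma atomic_count_zero_iff: "atomic \<Gamma> \<Longrightarrow> count \<Gamma> (Var p) = 0 \<longleftrightarrow> p \<notin> mset_vars \<Gamma>"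
  by (induction \<Gamma>) (auto simp: mset_vars_def)

lemma vars_simps [simp]:
  "mset_vars {#} = {}"
  "mset_vars (add_mset A \<Gamma>) = fm_vars A \<union> mset_vars \<Gamma>"
  "mset_vars (\<Gamma> + \<Delta>) = mset_vars \<Gamma> \<union> mset_vars \<Delta>"
  "hseq_vars {#} = {}"
  "hseq_vars (add_mset s G) = seq_vars s \<union> hseq_vars G"
  "hseq_vars (G + H) = hseq_vars G \<union> hseq_vars H"
  by (auto simp: mset_vars_def hseq_vars_def)

lemma mset_vars_repeat_mset: "mset_vars (repeat_mset n \<Gamma>) \<subseteq> mset_vars \<Gamma>"
  by (induction n) auto

lemma finite_fm_vars: "finite (fm_vars A)"
  by (induction A) auto

lemma finite_hseq_vars: "finite (hseq_vars G)"
proof -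
  have "finite (seq_vars s)" for s
    by (cases s) (auto simp: mset_vars_def finite_fm_vars)
  then show ?thesis by (auto simp: hseq_vars_def)
qed

lemma occs_simps [simp]:
  "occs p {#} = 0"
  "occs p (add_mset s G) = lcount p s + rcount p s + occs p G"
  "occs p (G + H) = occs p G + occs p H"
  by (auto simp: occs_def)

lemma occs_zero:
  assumes "\<forall>s\<in>#G. atomic_seq s" "occs p G = 0"
  shows "p \<notin> hseq_vars G"
  using assms
proof (induction G)
  case (add s G)
  then show ?case by (cases s) (auto simp: atomic_count_zero_iff)
qed simp

section \<open>Eliminating the focused variable\<close>

text \<open>Given a refutation of \<open>G\<close>, moving the value of \<open>p\<close> in one
  direction makes \<open>s\<close> negative and raises no other component, since \<open>p\<close>
  lies on the same side everywhere.\<close>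

lemma valid_drop_one_sided:
  assumes val: "\<Turnstile>\<^sub>A add_mset s G" and at: "atomic_seq s" "\<forall>s'\<in>#G. atomic_seq s'"
    and side: "(\<forall>s'\<in>#add_mset s G. rcount p s' = 0) \<and> 0 < lcount p s \<or>
               (\<forall>s'\<in>#add_mset s G. lcount p s' = 0) \<and> 0 < rcount p s"
  shows "\<Turnstile>\<^sub>A G"
  unfolding valid_def
proof (rule allI, rule ccontr)
  fix v assume "\<not> (\<exists>s'\<in>#G. holds v s')"
  then have neg: "seq_val v s' < 0" if "s' \<in># G" for s'
    using that by (auto simp: holds_iff_seq_val not_le)
  \<comment> \<open>At least one occurrence of \<open>p\<close> in \<open>s\<close> turns a move by
    \<open>d\<close> into a loss of at least \<open>d\<close>, which exceeds the value of
    \<open>s\<close>.\<close>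
  define d where "d = \<bar>seq_val v s\<bar> + 1"
  have d: "d \<ge> 0" "seq_val v s - d < 0" by (auto simp: d_def)
  have kd: "d \<le> of_nat k * d" if "k > 0" for k :: nat
    using that d(1) mult_right_mono[of 1 "of_nat k" d] by (cases k) auto
  have "\<exists>a. seq_val (v(p := a)) s < 0 \<and> (\<forall>s'\<in>#G. seq_val (v(p := a)) s' \<le> seq_val v s')"
    using side
  proof
    assume *: "(\<forall>s'\<in>#add_mset s G. rcount p s' = 0) \<and> 0 < lcount p s"
    show ?thesis
      by (rule exI[of _ "v p + d"]) (use * at d kd[of "lcount p s"] in \<open>auto simp: seq_val_upd\<close>)
  next
    assume *: "(\<forall>s'\<in>#add_mset s G. lcount p s' = 0) \<and> 0 < rcount p s"
    show ?thesis
      by (rule exI[of _ "v p - d"]) (use * at d kd[of "rcount p s"] in \<open>auto simp: seq_val_upd\<close>)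
  qed
  then obtain a where a: "seq_val (v(p := a)) s < 0"
    "\<And>s'. s' \<in># G \<Longrightarrow> seq_val (v(p := a)) s' \<le> seq_val v s'" by blast
  have "\<not> holds (v(p := a)) s'" if "s' \<in># add_mset s G" for s'
    using that a neg by (fastforce simp: holds_iff_seq_val)
  then show False using val unfolding valid_def by blast
qed

text \<open>If v refutes every component of G together with C and L, and w does so with R in place of L,
  then the combination below gives L and R the same negative value.\<close>

lemma valid_resolve:
  fixes m n :: nat
  assumes val: "\<Turnstile>\<^sub>A G + {#L#} + {#R#}"
    and at: "\<forall>s\<in>#G + {#L#} + {#R#}. atomic_seq s"
    and C: "\<And>u. seq_val u C = of_nat m * seq_val u L + of_nat n * seq_val u R"
    and mn: "m > 0" "n > 0"
  shows "\<Turnstile>\<^sub>A G + {#C#} + {#L#} \<or> \<Turnstile>\<^sub>A G + {#C#} + {#R#}"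
proof (rule ccontr)
  assume "\<not> ?thesis"
  then obtain v w where
    v: "\<And>s. s \<in># G \<Longrightarrow> seq_val v s < 0" "seq_val v C < 0" "seq_val v L < 0" and
    w: "\<And>s. s \<in># G \<Longrightarrow> seq_val w s < 0" "seq_val w C < 0" "seq_val w R < 0"
    unfolding valid_def by (auto simp: holds_iff_seq_val not_le)
  have no_refutation: False if "\<And>s. s \<in># G + {#L#} + {#R#} \<Longrightarrow> seq_val u s < 0" for u
    using val that unfolding valid_def by (meson holds_iff_seq_val not_le)
  define l1 l2 r1 r2 where "l1 = seq_val v L" and "l2 = seq_val w L"
    and "r1 = seq_val v R" and "r2 = seq_val w R"
  \<comment> \<open>Were \<open>R\<close> also negative at \<open>v\<close>, then \<open>v\<close>
    would refute the conclusion; likewise \<open>L\<close> at \<open>w\<close>.\<close>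
  have r1: "r1 \<ge> 0" using no_refutation[of v] v unfolding r1_def by fastforce
  have l2: "l2 \<ge> 0" using no_refutation[of w] w unfolding l2_def by fastforce
  have l1: "l1 < 0" and r2: "r2 < 0" using v w by (auto simp: l1_def r2_def)
  have c1: "of_nat n * r1 < of_nat m * (- l1)" and c2: "of_nat m * l2 < of_nat n * (- r2)"
    using v(2) w(2) C by (auto simp: l1_def l2_def r1_def r2_def)
  \<comment> \<open>The bounds \<open>c1\<close> and \<open>c2\<close> express that \<open>C\<close>
    is negative at \<open>v\<close> and at \<open>w\<close>. Their smaller sides are nonnegative, so
    they may be multiplied.\<close>
  have "(of_nat n * r1) * (of_nat m * l2) < (of_nat m * (- l1)) * (of_nat n * (- r2))"
    by (rule mult_strict_mono'[OF c1 c2]) (use r1 l2 in auto)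
  then have "of_nat (n * m) * (r1 * l2) < of_nat (n * m) * (l1 * r2)"
    by (simp add: algebra_simps)
  then have det: "r1 * l2 < l1 * r2"
    using mn by (simp add: mult_less_cancel_left_pos)
  \<comment> \<open>Both coefficients are positive, so \<open>u\<close> keeps \<open>G\<close>
    negative; they are chosen to equalise \<open>L\<close> and \<open>R\<close>, whose common value
    is negative by \<open>det\<close>.\<close>
  define u where "u = (\<lambda>q. (l2 - r2) * v q + (r1 - l1) * w q)"
  have u: "seq_val u s = (l2 - r2) * seq_val v s + (r1 - l1) * seq_val w s"
    if "s \<in># G + {#L#} + {#R#}" for s
    unfolding u_def by (rule seq_val_linear) (use that at in blast)
  have "seq_val u L = r1 * l2 - l1 * r2" "seq_val u R = r1 * l2 - l1 * r2"
    using u[of L] u[of R] by (auto simp: l1_def l2_def r1_def r2_def algebra_simps)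
  moreover have "seq_val u s < 0" if "s \<in># G" for s
  proof -
    have "(l2 - r2) * seq_val v s < 0" "(r1 - l1) * seq_val w s < 0"
      using v(1)[OF that] w(1)[OF that] l1 l2 r1 r2 by (auto intro: mult_pos_neg)
    then show ?thesis using u that by simp
  qed
  ultimately have "seq_val u s < 0" if "s \<in># G + {#L#} + {#R#}" for s
    using that det by auto
  then show False by (rule no_refutation)
qed

lemma GAt_cancel:
  assumes "GAt q (G + {#\<Gamma> \<turnstile> \<Delta>#})"
  shows "GAt q (G + {#add_mset A \<Gamma> \<turnstile> add_mset A \<Delta>#})"
proof -
  have "GAt q (G + {# {#A#} \<turnstile> {#A#} #})"
    using GAt_weaken[OF Ax[of q A], of G] by (simp add: add.commute)
  from M[OF this assms] show ?thesis by simp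
qed

lemma remove_replicate_mset:
  "\<exists>\<Gamma>'. \<Gamma> = \<Gamma>' + replicate_mset (count \<Gamma> a) a \<and> count \<Gamma>' a = 0"
  by (rule exI[of _ "filter_mset (\<lambda>b. b \<noteq> a) \<Gamma>"]) (auto simp: multiset_eq_iff)

text \<open>One backward use of (S'): the premise keeps \<open>L\<close> or \<open>R\<close> and
  trades the other for a component free of \<open>p\<close>, so \<open>occs p\<close> drops.\<close>

lemma GAt_resolve:
  assumes at: "\<forall>s\<in>#G + {#L#} + {#R#}. atomic_seq s"
    and val: "\<Turnstile>\<^sub>A G + {#L#} + {#R#}"
    and L: "lcount p L > 0" "rcount p L = 0" and R: "lcount p R = 0" "rcount p R > 0"
    and IH: "\<And>H. occs p H < occs p (G + {#L#} + {#R#}) \<Longrightarrow> \<forall>s\<in>#H. atomic_seq s \<Longrightarrow>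
               hseq_vars H \<subseteq> hseq_vars (G + {#L#} + {#R#}) \<Longrightarrow> \<Turnstile>\<^sub>A H \<Longrightarrow> GAt p H"
  shows "GAt p (G + {#L#} + {#R#})"
proof -
  define n m where "n = lcount p L" and "m = rcount p R"
  obtain \<Gamma>1 \<Delta>1 where L': "L = \<Gamma>1 + replicate_mset n (Var p) \<turnstile> \<Delta>1" "count \<Gamma>1 (Var p) = 0"
    unfolding n_def using remove_replicate_mset[of _ "Var p"] by (cases L) (metis lcount.simps)
  obtain \<Gamma>2 \<Delta>2 where R': "R = \<Gamma>2 \<turnstile> \<Delta>2 + replicate_mset m (Var p)" "count \<Delta>2 (Var p) = 0"
    unfolding m_def using remove_replicate_mset[of _ "Var p"] by (cases R) (metis rcount.simps)
  have atm: "atomic \<Gamma>1" "atomic \<Delta>1" "atomic \<Gamma>2" "atomic \<Delta>2"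
    using at L' R' by auto
  have cnt: "count \<Delta>1 (Var p) = 0" "count \<Gamma>2 (Var p) = 0"
    using L R L' R' by auto
  have np: "p \<notin> mset_vars \<Gamma>1" "p \<notin> mset_vars \<Delta>1" "p \<notin> mset_vars \<Gamma>2" "p \<notin> mset_vars \<Delta>2"
    using atomic_count_zero_iff atm cnt L' R' by blast+
  have pos: "n > 0" "m > 0" using L R by (auto simp: n_def m_def)
  \<comment> \<open>The multiplicities are crossed: \<open>m\<close> copies of \<open>L\<close>
    carry \<open>m * n\<close> occurrences of \<open>p\<close> on the left, \<open>n\<close> copies
    of \<open>R\<close> as many on the right. Omitting both leaves the value unchanged.\<close>
  define C where "C = repeat_mset m \<Gamma>1 + repeat_mset n \<Gamma>2 \<turnstile> repeat_mset m \<Delta>1 + repeat_mset n \<Delta>2"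
  have "seq_val u C = of_nat m * seq_val u L + of_nat n * seq_val u R" for u
    by (simp add: C_def L' R' algebra_simps)
  from valid_resolve[OF val at this pos(2,1)]
  obtain S where S: "S = L \<or> S = R" "\<Turnstile>\<^sub>A G + {#C#} + {#S#}" by blast
  have "GAt p (G + {#C#} + {#S#})"
  proof (rule IH)
    have "lcount p C + rcount p C = 0" using cnt L' R' by (simp add: C_def)
    then show "occs p (G + {#C#} + {#S#}) < occs p (G + {#L#} + {#R#})"
      using S(1) L R by auto
    have "atomic_seq C" using atm by (simp add: C_def atomic_repeat_mset)
    then show "\<forall>s\<in>#G + {#C#} + {#S#}. atomic_seq s" using at S(1) by auto
    have "seq_vars C \<subseteq> seq_vars L \<union> seq_vars R"
      using mset_vars_repeat_mset by (fastforce simp: C_def L' R')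
    then show "hseq_vars (G + {#C#} + {#S#}) \<subseteq> hseq_vars (G + {#L#} + {#R#})"
      using S(1) by auto
  qed fact
  then show ?thesis
    unfolding L'(1) R'(1) C_def by (rule S') (use atm pos np S(1) L'(1) R'(1) in auto)
qed

text \<open>The bound \<open>V\<close> survives every step; once \<open>p\<close> is gone the
  variables lie in \<open>V - {p}\<close>, where the first assumption takes over.\<close>

lemma GAt_eliminate:
  assumes "\<And>H. \<forall>s\<in>#H. atomic_seq s \<Longrightarrow> hseq_vars H \<subseteq> V - {p} \<Longrightarrow> \<Turnstile>\<^sub>A H \<Longrightarrow> GAt p H"
    and "\<forall>s\<in>#G. atomic_seq s" "hseq_vars G \<subseteq> V" "\<Turnstile>\<^sub>A G"
  shows "GAt p G"
  using assms(2-)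
proof (induction "occs p G" arbitrary: G rule: less_induct)
  case less
  \<comment> \<open>If no component has \<open>p\<close> on both sides and no pair has it on
    opposite sides, all its occurrences lie on one side.\<close>
  consider (none) "occs p G = 0"
    | (both) s where "s \<in># G" "lcount p s > 0" "rcount p s > 0"
    | (resolve) L R where "L \<in># G" "R \<in># G" "lcount p L > 0" "rcount p L = 0"
        "lcount p R = 0" "rcount p R > 0"
    | (drop) s where "s \<in># G" "(\<forall>s'\<in>#G. rcount p s' = 0) \<and> 0 < lcount p s \<or>
               (\<forall>s'\<in>#G. lcount p s' = 0) \<and> 0 < rcount p s"
  proof -
    have "\<exists>s\<in>#G. lcount p s > 0 \<or> rcount p s > 0" if "occs p G \<noteq> 0"
      using that by (auto simp: occs_def)
    then show thesis using that by (metis gr0I)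
  qed
  then show ?case
  proof cases
    case none
    then have "p \<notin> hseq_vars G" using occs_zero less.prems by blast
    then show ?thesis using assms(1) less.prems by blast
  next
    case both
    obtain \<Gamma> \<Delta> where s: "s = add_mset (Var p) \<Gamma> \<turnstile> add_mset (Var p) \<Delta>"
      using both(2,3) by (cases s) (fastforce dest!: multi_member_split)
    obtain G' where G: "G = G' + {#s#}"
      using both(1) by (metis add_mset_add_single multi_member_split)
    have "\<Turnstile>\<^sub>A G' + {#\<Gamma> \<turnstile> \<Delta>#}"
      \<comment> \<open>Deleting one \<open>p\<close> from each side does not change the value of
        the component.\<close>
      using less.prems(3) unfolding G by (rule valid_replace) (auto simp: s)
    then have "GAt p (G' + {#\<Gamma> \<turnstile> \<Delta>#})"
      by (intro less.hyps) (use less.prems in \<open>auto simp: G s\<close>)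
    then show ?thesis unfolding G s by (rule GAt_cancel)
  next
    case resolve
    then have "L \<noteq> R" by auto
    then obtain G' where G: "G = G' + {#L#} + {#R#}"
      using resolve(1,2)
      by (metis add_mset_add_single insert_noteq_member multi_member_split)
    show ?thesis unfolding G
    proof (rule GAt_resolve)
      fix H assume "occs p H < occs p (G' + {#L#} + {#R#})" "\<forall>s\<in>#H. atomic_seq s"
        "hseq_vars H \<subseteq> hseq_vars (G' + {#L#} + {#R#})" "\<Turnstile>\<^sub>A H"
      then show "GAt p H" using less.hyps[of H] less.prems(2) unfolding G by blast
    qed (use less.prems resolve in \<open>simp_all add: G\<close>)
  next
    case drop
    obtain G' where G: "G = add_mset s G'" using drop(1) by (metis multi_member_split)
    have val: "\<Turnstile>\<^sub>A G'"
      by (rule valid_drop_one_sided[of s G' p]) (use less.prems drop(2) in \<open>auto simp: G\<close>)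
    have "GAt p G'"
      by (rule less.hyps) (use less.prems drop(2) val in \<open>auto simp: G\<close>)
    then show ?thesis using GAt_weaken[of p G' "{#s#}"] valid_nonempty[OF val] by (simp add: G)
  qed
qed

section \<open>Induction on the number of variables\<close>

lemma GAt_no_vars:
  assumes "\<forall>s\<in>#G. atomic_seq s" "hseq_vars G = {}" "G \<noteq> {#}"
  shows "GAt p G"
proof -
  have empty: "\<Gamma> = {#}" if "atomic \<Gamma>" "mset_vars \<Gamma> = {}" for \<Gamma>
    using that by (cases \<Gamma>) auto
  obtain s G' where G: "G = {#s#} + G'" using assms(3) by (cases G) auto
  have "s = {#} \<turnstile> {#}" using assms(1,2) empty by (cases s) (auto simp: G)
  then show ?thesis using GAt_weaken[OF AxEmpty, of p G'] by (simp add: G)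
qed

lemma GAt_atomic:
  assumes "\<forall>s\<in>#G. atomic_seq s" "\<Turnstile>\<^sub>A G"
  shows "GAt p G"
  using assms
proof (induction "card (hseq_vars G)" arbitrary: G p rule: less_induct)
  case less
  have occ: "GAt q G" if q: "q \<in> hseq_vars G" for q
  proof (rule GAt_eliminate[OF _ less.prems(1) order_refl less.prems(2)])
    \<comment> \<open>Here \<open>q\<close> has vanished from \<open>H\<close> but is still the
      focus, so the induction hypothesis must cover foci outside the hypersequent.\<close>
    fix H assume H: "\<forall>s\<in>#H. atomic_seq s" "hseq_vars H \<subseteq> hseq_vars G - {q}" "\<Turnstile>\<^sub>A H"
    then have "card (hseq_vars H) < card (hseq_vars G)"
      using q finite_hseq_vars by (intro psubset_card_mono) auto
    then show "GAt q H" using less.hyps H by blast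
  qed
  consider "p \<in> hseq_vars G" | "hseq_vars G = {}" | q where "p \<notin> hseq_vars G" "q \<in> hseq_vars G"
    by blast
  then show ?case
  proof cases
    case 1
    then show ?thesis by (rule occ)
  next
    case 2
    then show ?thesis using GAt_no_vars less.prems valid_nonempty by blast
  next
    \<comment> \<open>Eliminate with a focus \<open>q\<close> that occurs in \<open>G\<close>;
      (shift) then turns the result into one with focus \<open>p\<close>.\<close>
    case 3
    then show ?thesis using occ shift by blast
  qed
qed

theorem mainTheorem10:
  fixes G :: hypersequent
  assumes "\<Turnstile>\<^sub>A G"
  shows "\<forall>p :: pvar. GAt p G"
  using GAt_of_atomic[OF GAt_atomic assms] by blast

end
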